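(* Let $p\geq3$ be a prime and let $A\in\mathbb{Z}_p$ be written as $A=\sum_{i=0}^{\infty}a_ip^i=\sum_{j=0}^{\infty}b_jp^j$ with $a_i\in\{0,\pm1,\ldots,\pm\frac{p-1}{2}\}$ and $b_j\in\{0,1,\ldots,p-1\}$. Then for every $t\geq0$, $$b_t\equiv a_t+f_t(a_0,\ldots,a_{t-1})\pmod p,\qquad a_t\equiv b_t+g_t(b_0,\ldots,b_{t-1})\pmod p.$$
   Context: Define $$f_t(x_0,\ldots,x_{t-1})=\sum_{\lambda=0}^{t-1}\Bigl\{\sum_{c=1}^{\frac{p-1}{2}}\bigl[(x_\lambda+c)^{p-1}-1\bigr]\Bigr\}\prod_{\lambda<i<t}(1-x_i^{p-1}),$$ $$g_t(y_0,\ldots,y_{t-1})=\sum_{\lambda=0}^{t-1}\Bigl\{\sum_{c=\frac{p+1}{2}}^{p-1}\bigl[1-(y_\lambda-c)^{p-1}\bigr]\Bigr\}\prod_{\lambda<i<t}\Bigl[1-\bigl(y_i-\tfrac{p-1}{2}\bigr)^{p-1}\Bigr],$$ with the conventions that an empty product is $1$ and an empty sum is $0$ (so $f_0=g_0=0$). *)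

theory Defs
  imports "HOL-Analysis.Analysis" "HOL-Algebra.Ring" "HOL-Number_Theory.Cong"
begin

text \<open>
  The ring of p-adic integers as the inverse limit of the rings of integers modulo \<open>p ^ n\<close>:
  the \<open>n\<close>-th component of an element is its residue modulo \<open>p ^ n\<close>, represented in \<open>{0..<p ^ n}\<close>.
\<close>

definition padic_int :: "nat \<Rightarrow> (nat \<Rightarrow> int) ring" where
  "padic_int p =
    \<lparr>carrier = {x. \<forall>n. x n \<in> {0..<int p ^ n} \<and> x (Suc n) mod int p ^ n = x n},
     monoid.mult = (\<lambda>x y n. (x n * y n) mod int p ^ n),
     one = (\<lambda>n. 1 mod int p ^ n),
     zero = (\<lambda>n. 0),
     add = (\<lambda>x y n. (x n + y n) mod int p ^ n)\<rparr>"

text \<open>The p-adic topology, i.e. the inverse limit of the discrete topologies.\<close>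

definition padic_topology :: "nat \<Rightarrow> (nat \<Rightarrow> int) topology" where
  "padic_topology p =
    subtopology (product_topology (\<lambda>n. discrete_topology {0..<int p ^ n}) UNIV)
      (carrier (padic_int p))"

definition padic_sums :: "nat \<Rightarrow> (nat \<Rightarrow> nat \<Rightarrow> int) \<Rightarrow> (nat \<Rightarrow> int) \<Rightarrow> bool" where
  "padic_sums p u A \<longleftrightarrow>
    limitin (padic_topology p) (\<lambda>N. finsum (padic_int p) u {..<N}) A sequentially"

text \<open>\<open>A = d\<^sub>0 + d\<^sub>1 p + d\<^sub>2 p\<^sup>2 + \<dots>\<close>; an integer \<open>k\<close> is seen in the ring as \<open>k\<close> times its unit.\<close>

definition padic_expansion :: "nat \<Rightarrow> (nat \<Rightarrow> int) \<Rightarrow> (nat \<Rightarrow> int) \<Rightarrow> bool" where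
  "padic_expansion p d A \<longleftrightarrow>
    padic_sums p
      (\<lambda>i. ([d i] \<cdot>\<^bsub>padic_int p\<^esub> \<one>\<^bsub>padic_int p\<^esub>) \<otimes>\<^bsub>padic_int p\<^esub>
           (([int p] \<cdot>\<^bsub>padic_int p\<^esub> \<one>\<^bsub>padic_int p\<^esub>) [^]\<^bsub>padic_int p\<^esub> i)) A"

text \<open>The functions \<open>f\<^sub>t\<close> and \<open>g\<^sub>t\<close>; only the arguments \<open>x 0, \<dots>, x (t - 1)\<close> occur.\<close>

definition f_corr :: "nat \<Rightarrow> nat \<Rightarrow> (nat \<Rightarrow> int) \<Rightarrow> int" where
  "f_corr p t x =
    (\<Sum>l<t. (\<Sum>c = 1..(p - 1) div 2. (x l + int c) ^ (p - 1) - 1) *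
            (\<Prod>i\<in>{l<..<t}. 1 - x i ^ (p - 1)))"

definition g_corr :: "nat \<Rightarrow> nat \<Rightarrow> (nat \<Rightarrow> int) \<Rightarrow> int" where
  "g_corr p t y =
    (\<Sum>l<t. (\<Sum>c = (p + 1) div 2..p - 1. 1 - (y l - int c) ^ (p - 1)) *
            (\<Prod>i\<in>{l<..<t}. 1 - (y i - int ((p - 1) div 2)) ^ (p - 1)))"

lemma padic_int_cring:
  assumes "p > 0"
  shows "cring (padic_int p)"
proof -
  have pw: "int p ^ n > 0" for n using assms by simp
  have dv: "(a mod int p ^ Suc n) mod int p ^ n = a mod int p ^ n" for a :: int and n
    by (rule mod_mod_cancel) simp
  have one: "\<one>\<^bsub>padic_int p\<^esub> \<in> carrier (padic_int p)"
    using pw dv by (simp add: padic_int_def)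
  have cl: "(\<lambda>n. F (x n) (y n) mod int p ^ n) \<in> carrier (padic_int p)"
    if "x \<in> carrier (padic_int p)" "y \<in> carrier (padic_int p)"
      and F: "\<And>a b m. F (a mod m) (b mod m) mod m = F a b mod m"
    for x y and F :: "int \<Rightarrow> int \<Rightarrow> int"
  proof -
    have "F (x (Suc n)) (y (Suc n)) mod int p ^ n = F (x n) (y n) mod int p ^ n" for n
      using that(1,2) F[of "x (Suc n)" "int p ^ n" "y (Suc n)"] by (simp add: padic_int_def)
    then show ?thesis using pw dv by (simp add: padic_int_def)
  qed
  have md: "x n mod int p ^ n = x n" if "x \<in> carrier (padic_int p)" for x n
    using that by (simp add: padic_int_def)
  show ?thesis
  proof (intro cringI abelian_groupI comm_monoidI)
    fix x assume x: "x \<in> carrier (padic_int p)"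
    show "\<exists>y\<in>carrier (padic_int p). y \<oplus>\<^bsub>padic_int p\<^esub> x = \<zero>\<^bsub>padic_int p\<^esub>"
    proof (rule bexI)
      show "(\<lambda>n. (0 - x n) mod int p ^ n) \<in> carrier (padic_int p)"
        by (rule cl[of "\<lambda>n. 0" x "\<lambda>a b. a - b"])
           (use x pw in \<open>simp_all add: mod_diff_eq padic_int_def\<close>)
      show "(\<lambda>n. (0 - x n) mod int p ^ n) \<oplus>\<^bsub>padic_int p\<^esub> x = \<zero>\<^bsub>padic_int p\<^esub>"
        by (simp add: padic_int_def mod_add_left_eq)
    qed
  next
    fix x y assume "x \<in> carrier (padic_int p)" "y \<in> carrier (padic_int p)"
    then show "x \<oplus>\<^bsub>padic_int p\<^esub> y \<in> carrier (padic_int p)"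
      using cl[of x y "(+)"] by (simp add: padic_int_def mod_add_eq)
  next
    fix x y assume "x \<in> carrier (padic_int p)" "y \<in> carrier (padic_int p)"
    then show "x \<otimes>\<^bsub>padic_int p\<^esub> y \<in> carrier (padic_int p)"
      using cl[of x y "(*)"] by (simp add: padic_int_def mod_mult_eq)
  qed (use one pw md in \<open>auto simp: padic_int_def fun_eq_iff mod_simps algebra_simps\<close>)
qed

end

theory Submission
  imports Defs "HOL-Algebra.IntRing" "HOL-Algebra.Elementary_Groups" "HOL-Number_Theory.Residues"
begin

text \<open>
  The truncations of the two expansions after \<open>t\<close> digits are congruent to \<open>A\<close>, hence to each other,
  modulo \<open>p ^ t\<close>, so they differ by \<open>p ^ t * e t\<close> for a carry \<open>e t\<close> with
  \<open>p * e (t + 1) = e t + b t - a t\<close>. The ranges of the digits force \<open>e t \<in> {0, 1}\<close> and determine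
  \<open>e (t + 1)\<close> from \<open>e t\<close> and either one of \<open>a t\<close>, \<open>b t\<close>: the digit creates a carry, propagates
  the incoming one or absorbs it. By Fermat's little theorem \<open>1 - z ^ (p - 1)\<close> is, modulo \<open>p\<close>, the
  indicator of \<open>p dvd z\<close>, so \<open>- f\<^sub>t\<close> and \<open>g\<^sub>t\<close> both say that the last digit that does not
  propagate creates a carry.
\<close>

section \<open>Digit expansions of p-adic integers\<close>

lemma int_ring_hom_eq_add_pow_one:
  assumes "ring R" and "h \<in> ring_hom \<Z> R"
  shows "h k = [k] \<cdot>\<^bsub>R\<^esub> \<one>\<^bsub>R\<^esub>"
proof -
  interpret R: ring R by fact
  have "h \<in> hom integer_group (add_monoid R)"
    using ring_hom_closed[OF assms(2)] ring_hom_add[OF assms(2)] by (auto intro: homI)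
  from hom_int_pow[OF this, of 1 k] have "h k = [k] \<cdot>\<^bsub>R\<^esub> h 1"
    by (simp add: R.add.is_group add_pow_def)
  then show ?thesis
    using ring_hom_one[OF assms(2)] by simp
qed

definition padic_of_int :: "nat \<Rightarrow> int \<Rightarrow> nat \<Rightarrow> int" where
  "padic_of_int p k = (\<lambda>n. k mod int p ^ n)"

lemma padic_of_int_ring_hom:
  assumes "p > 0"
  shows "padic_of_int p \<in> ring_hom \<Z> (padic_int p)"
  by (rule ring_hom_memI)
    (use assms in \<open>auto simp: padic_of_int_def padic_int_def mod_mod_cancel mod_simps\<close>)

definition truncation :: "nat \<Rightarrow> (nat \<Rightarrow> int) \<Rightarrow> nat \<Rightarrow> int" where
  "truncation p d n = (\<Sum>i<n. d i * int p ^ i)"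

lemma truncation_0 [simp]: "truncation p d 0 = 0"
  by (simp add: truncation_def)

lemma truncation_Suc: "truncation p d (Suc n) = truncation p d n + d n * int p ^ n"
  by (simp add: truncation_def)

lemma truncation_cong:
  assumes "n \<le> N"
  shows "[truncation p d N = truncation p d n] (mod int p ^ n)"
  using assms
proof (induction N rule: dec_induct)
  case (step N)
  have "[d N * int p ^ N = 0] (mod int p ^ n)"
    using step.hyps by (simp add: cong_0_iff le_imp_power_dvd)
  from cong_add[OF step.IH this] show ?case
    by (simp add: truncation_Suc)
qed simp

lemma finsum_padic_digits:
  assumes "p > 0"
  shows "(\<Oplus>\<^bsub>padic_int p\<^esub>i\<in>{..<N}. ([d i] \<cdot>\<^bsub>padic_int p\<^esub> \<one>\<^bsub>padic_int p\<^esub>) \<otimes>\<^bsub>padic_int p\<^esub>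
           (([int p] \<cdot>\<^bsub>padic_int p\<^esub> \<one>\<^bsub>padic_int p\<^esub>) [^]\<^bsub>padic_int p\<^esub> i))
         = padic_of_int p (truncation p d N)"
proof -
  interpret ring_hom_cring \<Z> "padic_int p" "padic_of_int p"
    using assms padic_of_int_ring_hom
    by (intro ring_hom_cring.intro ring_hom_cring_axioms.intro int_is_cring padic_int_cring)
  have multiple: "[k] \<cdot>\<^bsub>padic_int p\<^esub> \<one>\<^bsub>padic_int p\<^esub> = padic_of_int p k" for k :: int
    using int_ring_hom_eq_add_pow_one[OF S.ring_axioms homh] by simp
  have mult: "padic_of_int p k \<otimes>\<^bsub>padic_int p\<^esub> padic_of_int p l = padic_of_int p (k * l)" for k l
    using hom_mult[of k l] by simp
  have power: "padic_of_int p k [^]\<^bsub>padic_int p\<^esub> i = padic_of_int p (k ^ i)" for k and i :: nat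
    by (induction i) (use hom_one in \<open>simp_all add: mult power_Suc2 del: power_Suc\<close>)
  show ?thesis
    using hom_finsum[of "\<lambda>i. d i * int p ^ i" "{..<N}"]
    by (simp only: multiple power mult truncation_def comp_def
        int_finsum_eq int_carrier_eq Pi_UNIV UNIV_I)
qed

lemma limitin_discrete_topology:
  "limitin (discrete_topology U) f l F \<longleftrightarrow> l \<in> U \<and> (\<forall>\<^sub>F x in F. f x = l)"
proof
  assume "limitin (discrete_topology U) f l F"
  then show "l \<in> U \<and> (\<forall>\<^sub>F x in F. f x = l)"
    using limitinD[of "discrete_topology U" f l F "{l}"] limitin_topspace by fastforce
qed (auto simp: limitin_def elim: eventually_mono)

lemma limitin_padic_topology:
  "limitin (padic_topology p) f A F \<longleftrightarrow>
     A \<in> carrier (padic_int p) \<and> (\<forall>\<^sub>F x in F. f x \<in> carrier (padic_int p)) \<and>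
     (\<forall>n. \<forall>\<^sub>F x in F. f x n = A n)"
proof -
  have "x n \<in> {0..<int p ^ n}" if "x \<in> carrier (padic_int p)" for x n
    using that by (simp add: padic_int_def)
  then show ?thesis
    unfolding padic_topology_def
    by (auto simp: limitin_subtopology limitin_componentwise limitin_discrete_topology
        elim: eventually_mono)
qed

lemma padic_expansion_imp_truncation:
  assumes "p > 0" and "padic_expansion p d A"
  shows "A n = truncation p d n mod int p ^ n"
proof -
  have "\<forall>\<^sub>F N in sequentially. truncation p d N mod int p ^ n = A n"
    using assms(2)
    by (simp add: padic_expansion_def padic_sums_def finsum_padic_digits[OF assms(1)]
        limitin_padic_topology padic_of_int_def)
  then obtain N where "truncation p d N mod int p ^ n = A n" and "N \<ge> n"
    using eventually_happens'[OF sequentially_bot eventually_conj[OF _ eventually_ge_at_top[of n]]]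
    by blast
  then show ?thesis
    using truncation_cong[of n N p d] by (simp add: cong_def)
qed

section \<open>The carry between two expansions\<close>

locale congruent_expansions =
  fixes p :: nat and a b :: "nat \<Rightarrow> int"
  assumes p_pos: "p > 0"
    and truncations_cong: "\<And>t. [truncation p a t = truncation p b t] (mod int p ^ t)"
begin

definition carry :: "nat \<Rightarrow> int" where
  "carry t = (truncation p b t - truncation p a t) div int p ^ t"

lemma carry_0: "carry 0 = 0"
  by (simp add: carry_def)

lemma power_mult_carry: "int p ^ t * carry t = truncation p b t - truncation p a t"
  using cong_sym[OF truncations_cong] by (simp add: carry_def cong_iff_dvd_diff)

lemma carry_Suc: "int p * carry (Suc t) = carry t + b t - a t"
proof -
  have "int p ^ t * (int p * carry (Suc t)) = int p ^ t * (carry t + b t - a t)"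
    using power_mult_carry[of t] power_mult_carry[of "Suc t"]
    by (simp add: truncation_Suc algebra_simps)
  then show ?thesis
    using p_pos by simp
qed

lemma digits_cong_carry: "[b t = a t - carry t] (mod int p)" "[a t = b t + carry t] (mod int p)"
proof -
  have "int p dvd carry t + b t - a t"
    by (metis carry_Suc dvd_triv_left)
  then show "[b t = a t - carry t] (mod int p)" "[a t = b t + carry t] (mod int p)"
    by (simp_all add: cong_iff_dvd_diff algebra_simps dvd_diff_commute)
qed

end

locale balanced_and_standard_expansions = congruent_expansions +
  fixes h :: nat
  assumes p_eq: "p = 2 * h + 1"
    and balanced_digit: "\<And>i. a i \<in> {- int h..int h}"
    and standard_digit: "\<And>i. b i \<in> {0..2 * int h}"
begin

lemma int_p_eq: "int p = 2 * int h + 1"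
  by (simp add: p_eq)

lemma carry_cases: "carry t = 0 \<or> carry t = 1"
proof (induction t)
  case (Suc t)
  have "int p * carry (Suc t) > int p * (- 1)" "int p * carry (Suc t) < int p * 2"
    unfolding carry_Suc using Suc balanced_digit[of t] standard_digit[of t] int_p_eq by auto
  then have "- 1 < carry (Suc t)" "carry (Suc t) < 2"
    using p_pos by (simp_all only: mult_less_cancel_left_pos of_nat_0_less_iff)
  then show ?case by linarith
qed (simp add: carry_0)

lemma carry_Suc_balanced:
  "carry (Suc t) = (if a t < 0 then 1 else if a t = 0 then carry t else 0)"
  using carry_Suc[of t] carry_cases[of t] carry_cases[of "Suc t"]
    balanced_digit[of t] standard_digit[of t] by (auto simp: int_p_eq)

lemma carry_Suc_standard:
  "carry (Suc t) = (if b t > int h then 1 else if b t = int h then carry t else 0)"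
  using carry_Suc[of t] carry_cases[of t] carry_cases[of "Suc t"]
    balanced_digit[of t] standard_digit[of t] by (auto simp: int_p_eq)

end

section \<open>The correction polynomials\<close>

lemma fermat_theorem_int:
  assumes "prime p" and "\<not> int p dvd z"
  shows "[z ^ (p - 1) = 1] (mod int p)"
proof -
  have "residues (int p)"
    using prime_gt_1_nat[OF assms(1)] by (simp add: residues_def)
  moreover have "coprime z (int p)"
    using prime_imp_coprime[of "int p" z] assms by (simp add: coprime_commute)
  ultimately show ?thesis
    using residues.euler_theorem[of "int p" z] by (simp add: totient_prime[OF assms(1)])
qed

lemma one_minus_power_cong_of_bool:
  assumes "prime p" and "\<bar>z\<bar> < int p"
  shows "[1 - z ^ (p - 1) = of_bool (z = 0)] (mod int p)"
proof (cases "z = 0")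
  case True
  then show ?thesis
    using prime_gt_1_nat[OF assms(1)] by (simp add: power_0_left)
next
  case False
  then have "\<not> int p dvd z"
    using assms(2) dvd_imp_le_int[of z "int p"] by auto
  from cong_diff[OF cong_refl[of 1] fermat_theorem_int[OF assms(1) this]] show ?thesis
    using False by simp
qed

text \<open>The digits in \<open>C\<close> create a carry and the digit \<open>m\<close> propagates the incoming one.\<close>

definition correction :: "nat \<Rightarrow> int set \<Rightarrow> int \<Rightarrow> nat \<Rightarrow> (nat \<Rightarrow> int) \<Rightarrow> int" where
  "correction p C m t x =
    (\<Sum>l<t. (\<Sum>c\<in>C. 1 - (x l - c) ^ (p - 1)) * (\<Prod>i\<in>{l<..<t}. 1 - (x i - m) ^ (p - 1)))"

lemma correction_0: "correction p C m 0 x = 0"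
  by (simp add: correction_def)

lemma correction_Suc:
  "correction p C m (Suc t) x =
    (\<Sum>c\<in>C. 1 - (x t - c) ^ (p - 1)) + correction p C m t x * (1 - (x t - m) ^ (p - 1))"
proof -
  have "{l<..<Suc t} = insert t {l<..<t}" if "l < t" for l using that by auto
  then show ?thesis
    by (simp add: correction_def sum_distrib_left sum_distrib_right mult_ac)
qed

lemma correction_Suc_cong:
  assumes "prime p" and "finite C" and "\<And>c. c \<in> insert m C \<Longrightarrow> \<bar>x t - c\<bar> < int p"
  shows "[correction p C m (Suc t) x
           = of_bool (x t \<in> C) + correction p C m t x * of_bool (x t = m)] (mod int p)"
proof -
  have indicator: "[1 - (x t - c) ^ (p - 1) = of_bool (x t = c)] (mod int p)"
    if "c \<in> insert m C" for c
    using one_minus_power_cong_of_bool[OF assms(1) assms(3)[OF that]] by simp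
  have "[(\<Sum>c\<in>C. 1 - (x t - c) ^ (p - 1)) = (\<Sum>c\<in>C. of_bool (x t = c))] (mod int p)"
    by (intro cong_sum indicator) simp
  also have "(\<Sum>c\<in>C. of_bool (x t = c)) = (of_bool (x t \<in> C) :: int)"
    using assms(2) by (simp add: of_bool_def)
  finally show ?thesis
    unfolding correction_Suc by (intro cong_add cong_mult cong_refl indicator) simp_all
qed

lemma correction_cong_recurrence:
  assumes "prime p" and "finite C" and "m \<notin> C"
    and "\<And>i c. c \<in> insert m C \<Longrightarrow> \<bar>x i - c\<bar> < int p"
    and "e 0 = 0" and "\<And>i. e (Suc i) = (if x i \<in> C then 1 else if x i = m then e i else 0)"
  shows "[correction p C m t x = e t] (mod int p)"
proof (induction t)
  case 0
  show ?case by (simp add: correction_0 assms(5))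
next
  case (Suc t)
  have "[correction p C m (Suc t) x
      = of_bool (x t \<in> C) + correction p C m t x * of_bool (x t = m)] (mod int p)"
    by (rule correction_Suc_cong) (use assms in auto)
  also have "[of_bool (x t \<in> C) + correction p C m t x * of_bool (x t = m)
      = of_bool (x t \<in> C) + e t * of_bool (x t = m)] (mod int p)"
    by (intro cong_add cong_mult cong_refl Suc.IH)
  also have "of_bool (x t \<in> C) + e t * of_bool (x t = m) = e (Suc t)"
    using assms(3) by (auto simp: assms(6))
  finally show ?case .
qed

lemma f_corr_eq_correction:
  "f_corr p t x = - correction p {- int ((p - 1) div 2)..- 1} 0 t x"
proof -
  have "(\<Sum>c = 1..h. (z + int c) ^ (p - 1) - 1) = - (\<Sum>c = - int h..- 1. 1 - (z - c) ^ (p - 1))"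
    for z h
    unfolding sum_negf[symmetric]
    by (rule sum.reindex_bij_witness[of _ "\<lambda>c. nat (- c)" "\<lambda>c. - int c"]) auto
  then show ?thesis
    by (simp add: f_corr_def correction_def sum_negf)
qed

lemma g_corr_eq_correction:
  "g_corr p t y = correction p {int ((p + 1) div 2)..int (p - 1)} (int ((p - 1) div 2)) t y"
proof -
  have "(\<Sum>c = j..k. 1 - (z - int c) ^ (p - 1)) = (\<Sum>c = int j..int k. 1 - (z - c) ^ (p - 1))"
    for z j k
    by (rule sum.reindex_bij_witness[of _ nat int]) auto
  then show ?thesis
    by (simp only: g_corr_def correction_def)
qed

context balanced_and_standard_expansions
begin

lemma f_corr_cong_carry:
  assumes "prime p"
  shows "[f_corr p t a = - carry t] (mod int p)"
proof -
  have "[correction p {- int h..- 1} 0 t a = carry t] (mod int p)"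
  proof (rule correction_cong_recurrence)
    show "\<bar>a i - c\<bar> < int p" if "c \<in> insert 0 {- int h..- 1}" for i c
      using that balanced_digit[of i] by (auto simp: int_p_eq)
    show "carry (Suc i) = (if a i \<in> {- int h..- 1} then 1 else if a i = 0 then carry i else 0)" for i
      using balanced_digit[of i] by (auto simp: carry_Suc_balanced)
  qed (use assms carry_0 in auto)
  then show ?thesis
    by (simp add: f_corr_eq_correction p_eq cong_minus_minus_iff)
qed

lemma g_corr_cong_carry:
  assumes "prime p"
  shows "[g_corr p t b = carry t] (mod int p)"
proof -
  have "[correction p {int h + 1..2 * int h} (int h) t b = carry t] (mod int p)"
  proof (rule correction_cong_recurrence)
    show "\<bar>b i - c\<bar> < int p" if "c \<in> insert (int h) {int h + 1..2 * int h}" for i c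
      using that standard_digit[of i] by (auto simp: int_p_eq)
    show "carry (Suc i) =
        (if b i \<in> {int h + 1..2 * int h} then 1 else if b i = int h then carry i else 0)" for i
      using standard_digit[of i] by (auto simp: carry_Suc_standard)
  qed (use assms carry_0 in auto)
  then show ?thesis
    by (simp add: g_corr_eq_correction p_eq add.commute)
qed

end

theorem theorem5p1:
  fixes p :: nat and A :: "nat \<Rightarrow> int" and a b :: "nat \<Rightarrow> int"
  assumes "prime p" and "p \<ge> 3"
    and "A \<in> carrier (padic_int p)"
    and "padic_expansion p a A" and "padic_expansion p b A"
    and "\<And>i. a i \<in> {- int ((p - 1) div 2)..int ((p - 1) div 2)}"
    and "\<And>j. b j \<in> {0..int p - 1}"
  shows "\<forall>t. [b t = a t + f_corr p t a] (mod int p) \<and> [a t = b t + g_corr p t b] (mod int p)"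
proof (intro allI conjI)
  fix t
  have "odd p" using assms(1,2) by (simp add: prime_odd_nat)
  then have p: "p = 2 * ((p - 1) div 2) + 1" by simp
  interpret balanced_and_standard_expansions p a b "(p - 1) div 2"
  proof
    show "[truncation p a n = truncation p b n] (mod int p ^ n)" for n
      using padic_expansion_imp_truncation[OF _ assms(4), of n]
        padic_expansion_imp_truncation[OF _ assms(5), of n] assms(2) by (simp add: cong_def)
    show "b i \<in> {0..2 * int ((p - 1) div 2)}" for i
      using assms(7)[of i] p by auto
  qed (use assms(2,6) p in auto)
  have "[a t - carry t = a t + f_corr p t a] (mod int p)"
    using cong_add[OF cong_refl cong_sym[OF f_corr_cong_carry[OF assms(1)]]] by simp
  with digits_cong_carry(1) show "[b t = a t + f_corr p t a] (mod int p)" by (rule cong_trans)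
  have "[b t + carry t = b t + g_corr p t b] (mod int p)"
    by (rule cong_add[OF cong_refl cong_sym[OF g_corr_cong_carry[OF assms(1)]]])
  with digits_cong_carry(2) show "[a t = b t + g_corr p t b] (mod int p)" by (rule cong_trans)
qed

end
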